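(* For every integer $n\geq 1$, the polynomial $P_n(x)$ is $\gamma$-positive, and so it is unimodal with mode in the middle (i.e. the index $n-1$ is a mode of $P_n(x)$, which is symmetric of degree $2n-2$).
   Context: Let $\mathcal{C}_n$ be the set of permutations (rearrangements) $\sigma=\sigma_1\cdots\sigma_{2n}$ of the multiset $\{1,1,2,2,\ldots,n,n\}$. For $\sigma\in\mathcal{C}_n$, $\mathrm{des}(\sigma)=\#\{i\in\{1,\ldots,2n-1\}:\sigma_i>\sigma_{i+1}\}$, and $P_n(x)=\sum_{\sigma\in\mathcal{C}_n}x^{\mathrm{des}(\sigma)}$. A polynomial $f(x)=\sum_{i=0}^d f_ix^i$ of degree $d$ is symmetric if $f_i=f_{d-i}$ for all $i$; it can then be written uniquely as $f(x)=\sum_{k=0}^{\lfloor d/2\rfloor}\gamma_kx^k(1+x)^{d-2k}$, and it is $\gamma$-positive if all $\gamma_k\geq 0$. It is unimodal with mode $m$ if $f_0\leq\cdots\leq f_m\geq\cdots\geq f_d$. *)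

theory Defs
  imports
    "HOL-Combinatorics.Multiset_Permutations"
    "HOL-Computational_Algebra.Polynomial"
begin

definition double_perms :: "nat \<Rightarrow> nat list set"
  where "double_perms n = permutations_of_multiset (mset_set {1..n} + mset_set {1..n})"

(* Positions are 0-based here: index i stands for the pair (\<sigma>\<^sub>i\<^sub>+\<^sub>1, \<sigma>\<^sub>i\<^sub>+\<^sub>2). *)
definition des :: "nat list \<Rightarrow> nat"
  where "des \<sigma> = card {i. Suc i < length \<sigma> \<and> \<sigma> ! i > \<sigma> ! Suc i}"

definition P :: "nat \<Rightarrow> real poly"
  where "P n = (\<Sum>\<sigma>\<in>double_perms n. monom 1 (des \<sigma>))"

definition symmetric_poly :: "real poly \<Rightarrow> bool"
  where "symmetric_poly f \<longleftrightarrow> (\<forall>i\<le>degree f. coeff f i = coeff f (degree f - i))"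

definition gamma_expansion :: "real poly \<Rightarrow> (nat \<Rightarrow> real) \<Rightarrow> bool"
  where "gamma_expansion f \<gamma> \<longleftrightarrow>
    f = (\<Sum>k\<le>degree f div 2. smult (\<gamma> k) ([:0, 1:] ^ k * [:1, 1:] ^ (degree f - 2 * k)))"

(* For symmetric f the values \<gamma> 0, ..., \<gamma> (degree f div 2) of an expansion exist and are
   uniquely determined by f, so the existential quantifier merely names them. *)
definition gamma_positive :: "real poly \<Rightarrow> bool"
  where "gamma_positive f \<longleftrightarrow> symmetric_poly f \<and>
    (\<exists>\<gamma>. gamma_expansion f \<gamma> \<and> (\<forall>k\<le>degree f div 2. \<gamma> k \<ge> 0))"

definition unimodal_with_mode :: "real poly \<Rightarrow> nat \<Rightarrow> bool"
  where "unimodal_with_mode f m \<longleftrightarrow> m \<le> degree f \<and>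
    (\<forall>i<m. coeff f i \<le> coeff f (Suc i)) \<and>
    (\<forall>i\<in>{m..<degree f}. coeff f i \<ge> coeff f (Suc i))"

end

theory Submission
  imports Defs
begin

text \<open>Inserting two copies of a new maximum into a permutation of length \<open>2 n\<close> with \<open>d\<close>
  descents creates no, one or two descents in \<open>C(d+2, 2)\<close>, \<open>(d+2) (2n-d)\<close> and \<open>C(2n-d, 2)\<close>
  ways. Hence \<open>P (n+1)\<close> arises from \<open>P n\<close> by a second-order differential operator, and this
  operator maps \<open>x^k (1+x)^e\<close>, where \<open>e + 2 k = 2 n - 2\<close>, to
  \<open>C(k+2, 2) x^k (1+x)^(e+2) + (k+2) (2e+1) x^(k+1) (1+x)^e + 2 e (e-1) x^(k+2) (1+x)^(e-2)\<close>.
  All three coefficients are nonnegative, so gamma-positivity propagates by induction; symmetry and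
  unimodality are inherited from the basis polynomials.\<close>

section \<open>Inserting two copies of a new maximum\<close>

lemma des_simps [simp]:
  "des [] = 0" "des [a] = 0"
  "des (a # b # ys) = (if a > b then Suc (des (b # ys)) else des (b # ys))"
proof -
  show "des [] = 0" "des [a] = 0" by (simp_all add: des_def)
  let ?D = "{i. Suc i < length (b # ys) \<and> (b # ys) ! i > (b # ys) ! Suc i}"
  have fin: "finite ?D" by (rule finite_subset[of _ "{..<length (b # ys)}"]) auto
  have "{i. Suc i < length (a # b # ys) \<and> (a # b # ys) ! i > (a # b # ys) ! Suc i}
      = (if a > b then {0} else {}) \<union> Suc ` ?D" (is "?L = ?R")
  proof (rule set_eqI)
    fix i show "i \<in> ?L \<longleftrightarrow> i \<in> ?R" by (cases i) auto
  qed
  moreover have "card ((if a > b then {0} else {}) \<union> Suc ` ?D)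
      = (if a > b then Suc (card ?D) else card ?D)"
    using fin by (auto simp: card_image card_insert_if)
  ultimately show "des (a # b # ys) = (if a > b then Suc (des (b # ys)) else des (b # ys))"
    unfolding des_def by (simp only:)
qed

text \<open>A front letter 0 lies below no letter and so creates no descent; this lets
  \<open>a = 0\<close> stand for "no preceding letter" below.\<close>

lemma des_Cons_0 [simp]: "des (0 # \<sigma>) = des \<sigma>"
  by (cases \<sigma>) auto

abbreviation X :: "real poly" where "X \<equiv> [:0, 1:]"
abbreviation U :: "real poly" where "U \<equiv> [:1, 1:]"

abbreviation des_monom :: "nat list \<Rightarrow> real poly" where
  "des_monom \<sigma> \<equiv> monom 1 (des \<sigma>)"

lemma des_monom_Cons_Cons:
  "des_monom (a # b # \<sigma>) = (if a > b then X else 1) * des_monom (b # \<sigma>)"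
  by (simp add: monom_Suc)

text \<open>The front letter \<open>a\<close> puts the descent at the junction into the weight, as a
  recursion on the first shuffled letter requires. Since \<open>shuffles\<close> yields a set, the
  two copies of a maximum are not distinguished.\<close>

definition shuffle_sum :: "nat \<Rightarrow> nat list \<Rightarrow> nat list \<Rightarrow> real poly" where
  "shuffle_sum a \<sigma> \<rho> = (\<Sum>\<tau>\<in>shuffles \<sigma> \<rho>. des_monom (a # \<tau>))"

lemma shuffle_sum_Nil [simp]:
  "shuffle_sum a \<sigma> [] = des_monom (a # \<sigma>)" "shuffle_sum a [] \<rho> = des_monom (a # \<rho>)"
  by (simp_all add: shuffle_sum_def)

text \<open>Shuffles split by their first letter, and \<open>y \<noteq> z\<close> makes the two
  classes disjoint.\<close>

lemma shuffle_sum_Cons: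
  assumes "y \<noteq> z"
  shows "shuffle_sum a (y # \<sigma>) (z # \<rho>) =
    (if a > y then X else 1) * shuffle_sum y \<sigma> (z # \<rho>) +
    (if a > z then X else 1) * shuffle_sum z (y # \<sigma>) \<rho>"
proof -
  have "shuffle_sum a (y # \<sigma>) (z # \<rho>) =
      (\<Sum>\<tau>\<in>(#) y ` shuffles \<sigma> (z # \<rho>). des_monom (a # \<tau>)) +
      (\<Sum>\<tau>\<in>(#) z ` shuffles (y # \<sigma>) \<rho>. des_monom (a # \<tau>))"
    unfolding shuffle_sum_def shuffles.simps using assms by (intro sum.union_disjoint) auto
  also have "\<dots> = (\<Sum>\<tau>\<in>shuffles \<sigma> (z # \<rho>). des_monom (a # y # \<tau>)) +
      (\<Sum>\<tau>\<in>shuffles (y # \<sigma>) \<rho>. des_monom (a # z # \<tau>))"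
    by (simp add: sum.reindex del: des_simps)
  finally show ?thesis
    unfolding des_monom_Cons_Cons shuffle_sum_def sum_distrib_left .
qed

lemma shuffle_sum_max:
  assumes "a < M" "\<forall>y\<in>set \<sigma>. y < M"
  defines "D \<equiv> of_nat (des (a # \<sigma>))" and "N \<equiv> of_nat (length \<sigma>)"
  shows "shuffle_sum a \<sigma> [M] = (D + 1 + (N - D) * X) * des_monom (a # \<sigma>)"
  using assms(1,2) unfolding D_def N_def
proof (induction \<sigma> arbitrary: a)
  case Nil
  then show ?case by (simp flip: one_pCons)
next
  case (Cons y \<sigma>)
  then have y: "y < M" "y \<noteq> M" by auto
  \<comment> \<open>The last summand places \<open>M\<close> directly after \<open>a\<close>: an
    ascent to \<open>M\<close>, a descent to \<open>y\<close>, and any descent from \<open>a\<close>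
    to \<open>y\<close> is lost.\<close>
  have "shuffle_sum a (y # \<sigma>) [M] =
      (if a > y then X else 1) * shuffle_sum y \<sigma> [M] + X * des_monom (y # \<sigma>)"
    using Cons.prems y by (simp add: shuffle_sum_Cons des_monom_Cons_Cons del: des_simps)
  also have "shuffle_sum y \<sigma> [M] =
      (of_nat (des (y # \<sigma>)) + 1 + (of_nat (length \<sigma>) - of_nat (des (y # \<sigma>))) * X)
       * des_monom (y # \<sigma>)"
    using Cons by simp
  finally have *: "shuffle_sum a (y # \<sigma>) [M] = (if a > y then X else 1) *
      ((of_nat (des (y # \<sigma>)) + 1 + (of_nat (length \<sigma>) - of_nat (des (y # \<sigma>))) * X)
       * des_monom (y # \<sigma>)) + X * des_monom (y # \<sigma>)" .
  have "of_nat (length (y # \<sigma>)) = (of_nat (length \<sigma>) + 1 :: real poly)"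
    "of_nat (des (a # y # \<sigma>)) =
      (if a > y then of_nat (des (y # \<sigma>)) + 1 else of_nat (des (y # \<sigma>)) :: real poly)"
    by simp_all
  then show ?case
    unfolding * des_monom_Cons_Cons
    by (cases "a > y") (simp_all add: algebra_simps
          del: mult_pCons_left mult_pCons_right des_simps)
qed

text \<open>Among the slots following the letters of \<open>a # \<sigma>\<close>, the \<open>D + 1\<close> slots that sit inside a
  descent or at the end absorb copies of \<open>M\<close> without a new descent, whereas each of the other
  \<open>N - D\<close> slots, when used, creates exactly one.\<close>

lemma shuffle_sum_max_max:
  assumes "a < M" "\<forall>y\<in>set \<sigma>. y < M"
  defines "D \<equiv> of_nat (des (a # \<sigma>))" and "N \<equiv> of_nat (length \<sigma>)"
  shows "2 * shuffle_sum a \<sigma> [M, M] =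
    ((D + 1) * (D + 2) + 2 * (D + 2) * (N - D) * X + (N - D) * (N - D - 1) * X\<^sup>2)
     * des_monom (a # \<sigma>)"
  using assms(1,2) unfolding D_def N_def
proof (induction \<sigma> arbitrary: a)
  case Nil
  then show ?case by (simp flip: one_pCons)
next
  case (Cons y \<sigma>)
  then have y: "y < M" "y \<noteq> M" "\<forall>y\<in>set \<sigma>. y < M" by auto
  define D N :: "real poly" where "D = of_nat (des (y # \<sigma>))" and "N = of_nat (length \<sigma>)"
  \<comment> \<open>If the first \<open>M\<close> directly follows \<open>a\<close>, then the second
    one comes after \<open>y\<close> or directly after the first; either way the step down to
    \<open>y\<close> contributes one \<open>X\<close>.\<close>
  have "2 * shuffle_sum a (y # \<sigma>) [M, M] =
      (if a > y then X else 1) * (2 * shuffle_sum y \<sigma> [M, M])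
      + 2 * (X * shuffle_sum y \<sigma> [M] + X * des_monom (y # \<sigma>))"
    using Cons.prems y
    by (simp add: shuffle_sum_Cons des_monom_Cons_Cons ring_distribs
          del: des_simps mult_pCons_left mult_pCons_right)
  also have "shuffle_sum y \<sigma> [M] = (D + 1 + (N - D) * X) * des_monom (y # \<sigma>)"
    unfolding D_def N_def using y by (intro shuffle_sum_max)
  also have "2 * shuffle_sum y \<sigma> [M, M] =
      ((D + 1) * (D + 2) + 2 * (D + 2) * (N - D) * X + (N - D) * (N - D - 1) * X\<^sup>2)
       * des_monom (y # \<sigma>)"
    unfolding D_def N_def using Cons.IH[OF y(1,3)] .
  finally have *: "2 * shuffle_sum a (y # \<sigma>) [M, M] =
      (if a > y then X else 1) * (((D + 1) * (D + 2) + 2 * (D + 2) * (N - D) * X +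
         (N - D) * (N - D - 1) * X\<^sup>2) * des_monom (y # \<sigma>)) +
      2 * (X * ((D + 1 + (N - D) * X) * des_monom (y # \<sigma>)) + X * des_monom (y # \<sigma>))" .
  have "of_nat (length (y # \<sigma>)) = N + 1" 
    "of_nat (des (a # y # \<sigma>)) = (if a > y then D + 1 else D)"
    by (simp_all add: D_def N_def)
  then show ?case
    unfolding * des_monom_Cons_Cons
    by (cases "a > y") (simp_all add: algebra_simps power2_eq_square
          del: mult_pCons_left mult_pCons_right des_simps)
qed

section \<open>Double permutations as shuffles\<close>

text \<open>Partitioning a word into its non-maximal letters and its maxima exhibits it as a shuffle
  of the two parts.\<close>

lemma double_perms_Suc:
  "double_perms (Suc n) = (\<Union>\<sigma>\<in>double_perms n. shuffles \<sigma> [Suc n, Suc n])"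
proof -
  let ?M = "Suc n"
  let ?A = "mset_set {1..n} + mset_set {1..n}"
  have ms: "mset_set {1..?M} + mset_set {1..?M} = ?A + {#?M, ?M#}"
    by (simp add: atLeastAtMostSuc_conv)
  show ?thesis
  proof (intro equalityI subsetI)
    fix \<tau> assume "\<tau> \<in> double_perms ?M"
    then have \<tau>: "mset \<tau> = ?A + {#?M, ?M#}"
      unfolding double_perms_def ms by (simp add: permutations_of_multiset_def)
    let ?\<sigma> = "filter (\<lambda>x. x \<noteq> ?M) \<tau>" and ?\<rho> = "filter (\<lambda>x. \<not> x \<noteq> ?M) \<tau>"
    have "mset ?\<sigma> = ?A"
      by (rule multiset_eqI) (simp add: \<tau> count_mset_set')
    then have "?\<sigma> \<in> double_perms n"
      by (simp add: double_perms_def permutations_of_multiset_def)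
    moreover have "mset ?\<rho> = mset [?M, ?M]"
      by (rule multiset_eqI) (simp add: \<tau> count_mset_set')
    then have "length ?\<rho> = 2" by (metis length_Cons list.size(3) mset_eq_length numeral_2_eq_2)
    then have "?\<rho> = replicate 2 ?M" by (intro replicate_eqI) auto
    then have "?\<rho> = [?M, ?M]" by (simp add: numeral_2_eq_2)
    ultimately show "\<tau> \<in> (\<Union>\<sigma>\<in>double_perms n. shuffles \<sigma> [?M, ?M])"
      using partition_in_shuffles[of \<tau> "\<lambda>x. x \<noteq> ?M"] by auto
  next
    fix \<tau> assume "\<tau> \<in> (\<Union>\<sigma>\<in>double_perms n. shuffles \<sigma> [?M, ?M])"
    then show "\<tau> \<in> double_perms ?M"
      unfolding double_perms_def ms permutations_of_multiset_def
      by (auto dest: mset_shuffles)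
  qed
qed

lemma double_perms_props:
  assumes "\<sigma> \<in> double_perms n"
  shows "length \<sigma> = 2 * n" "set \<sigma> = {1..n}"
proof -
  have m: "mset \<sigma> = mset_set {1..n} + mset_set {1..n}"
    using assms by (simp add: double_perms_def permutations_of_multiset_def)
  show "length \<sigma> = 2 * n" using arg_cong[OF m, of size] by simp
  show "set \<sigma> = {1..n}" using arg_cong[OF m, of set_mset] by simp
qed

text \<open>The union in \<open>double_perms_Suc\<close> is disjoint, because filtering out the
  maximum recovers \<open>\<sigma>\<close> from each shuffle.\<close>

lemma P_Suc_eq_sum:
  "P (Suc n) = (\<Sum>\<sigma>\<in>double_perms n. shuffle_sum 0 \<sigma> [Suc n, Suc n])"
proof -
  let ?M = "Suc n"
  have filt: "filter (\<lambda>x. x \<noteq> ?M) \<tau> = \<sigma>"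
    if "\<sigma> \<in> double_perms n" "\<tau> \<in> shuffles \<sigma> [?M, ?M]" for \<sigma> \<tau>
  proof -
    have "\<tau> \<in> partition (\<lambda>x. x \<noteq> ?M) -` {(\<sigma>, [?M, ?M])}"
      using that double_perms_props(2)[OF that(1)] by (subst inv_image_partition) auto
    then show ?thesis by (auto simp: comp_def)
  qed
  have "P ?M = (\<Sum>\<sigma>\<in>double_perms n. \<Sum>\<tau>\<in>shuffles \<sigma> [?M, ?M]. des_monom \<tau>)"
    unfolding P_def double_perms_Suc
  proof (rule sum.UNION_disjoint)
    show "finite (double_perms n)" by (simp add: double_perms_def)
    show "\<forall>\<sigma>\<in>double_perms n. \<forall>\<rho>\<in>double_perms n. \<sigma> \<noteq> \<rho> \<longrightarrow>
        shuffles \<sigma> [?M, ?M] \<inter> shuffles \<rho> [?M, ?M] = {}"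
      using filt by blast
  qed simp
  then show ?thesis by (simp add: shuffle_sum_def)
qed

section \<open>The recurrence as a differential operator\<close>

text \<open>Twice the map \<open>f \<mapsto> (1-x)^(m+2) (x^2 f / (1-x)^m)'' / 2\<close>, which is multiplication by
  \<open>C(j+2, 2)\<close> on the coefficients of the series \<open>f / (1-x)^m\<close>; the factor 2 avoids divisions.\<close>

definition ins_op :: "nat \<Rightarrow> real poly \<Rightarrow> real poly" where
  "ins_op m f = (1 - X)\<^sup>2 * (X\<^sup>2 * pderiv (pderiv f))
     + (4 * (1 - X)\<^sup>2 + 2 * of_nat m * X * (1 - X)) * (X * pderiv f)
     + (2 * (1 - X)\<^sup>2 + 4 * of_nat m * X * (1 - X) + of_nat m * (of_nat m + 1) * X\<^sup>2) * f"

lemma ins_op_add: "ins_op m (f + g) = ins_op m f + ins_op m g"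
  by (simp add: ins_op_def pderiv_add algebra_simps del: mult_pCons_left mult_pCons_right)

lemma ins_op_smult: "ins_op m (smult c f) = smult c (ins_op m f)"
  by (simp add: ins_op_def pderiv_smult smult_add_right del: mult_pCons_left mult_pCons_right)

lemma ins_op_0: "ins_op m 0 = 0"
  by (simp add: ins_op_def)

lemma ins_op_sum: "ins_op m (sum f A) = (\<Sum>a\<in>A. ins_op m (f a))"
  by (induction A rule: infinite_finite_induct) (simp_all add: ins_op_add ins_op_0)

text \<open>The Euler operator, for any \<open>p\<close> with derivative 1, serves both
  \<open>X\<close> and \<open>U\<close>; the factor \<open>p\<close> avoids the exponent
  \<open>k - 1\<close>.\<close>

lemma mult_pderiv_power:
  fixes p :: "real poly"
  assumes "pderiv p = 1"
  shows "p * pderiv (p ^ k) = of_nat k * p ^ k"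
proof (cases k)
  case (Suc j)
  have "smult (real (Suc j)) q = of_nat (Suc j) * q" for q
    by (simp add: of_nat_poly del: of_nat_Suc)
  then show ?thesis
    unfolding Suc pderiv_power_Suc using assms by (simp add: mult_ac del: of_nat_Suc)
qed simp

lemma X_pderiv_power: "X * pderiv (X ^ k) = of_nat k * X ^ k"
  and U_pderiv_power: "U * pderiv (U ^ k) = of_nat k * U ^ k"
  by (rule mult_pderiv_power, simp add: pderiv_pCons)+

text \<open>Differentiating the Euler relation for \<open>X ^ k\<close> gives the second derivative
  without a case split on small \<open>k\<close>.\<close>

lemma X_pderiv2_power:
  "X\<^sup>2 * pderiv (pderiv (X ^ k)) = of_nat k * (of_nat k - 1) * X ^ k"
proof -
  let ?p = "X ^ k"
  have "pderiv (X * pderiv ?p) = pderiv (of_nat k * ?p)"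
    by (simp only: X_pderiv_power)
  then have "X * pderiv (pderiv ?p) = (of_nat k - 1) * pderiv ?p"
    by (simp add: pderiv_mult pderiv_pCons algebra_simps flip: one_pCons
        del: mult_pCons_left mult_pCons_right)
  then have "X\<^sup>2 * pderiv (pderiv ?p) = (of_nat k - 1) * (X * pderiv ?p)"
    by (simp add: power2_eq_square mult.assoc mult.left_commute
        del: mult_pCons_left mult_pCons_right)
  then show ?thesis
    by (simp only: X_pderiv_power mult.assoc mult.left_commute)
qed

lemma monom_eq_X_power: "monom 1 d = X ^ d"
  by (simp add: monom_altdef)

lemma ins_op_monom_ring_identity:
  fixes x p D N :: "'a :: comm_ring_1"
  shows "(1 - x)\<^sup>2 * (D * (D - 1) * p)
     + (4 * (1 - x)\<^sup>2 + 2 * (1 + N) * x * (1 - x)) * (D * p)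
     + (2 * (1 - x)\<^sup>2 + 4 * (1 + N) * x * (1 - x) + (1 + N) * (1 + N + 1) * x\<^sup>2) * p =
    ((D + 1) * (D + 2) + 2 * (D + 2) * (N - D) * x + (N - D) * (N - D - 1) * x\<^sup>2) * p"
  by (simp add: algebra_simps power2_eq_square)

text \<open>The factor is that of \<open>shuffle_sum_max_max\<close> for a word of length
  \<open>L\<close>, and \<open>Suc L\<close> is its number of slots. By linearity, the insertion
  count becomes an operator on \<open>P n\<close>.\<close>

lemma ins_op_monom:
  fixes L d :: nat
  defines "D \<equiv> of_nat d" and "N \<equiv> of_nat L"
  shows "ins_op (Suc L) (monom 1 d) =
    ((D + 1) * (D + 2) + 2 * (D + 2) * (N - D) * X + (N - D) * (N - D - 1) * X\<^sup>2) * monom 1 d"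
  unfolding ins_op_def monom_eq_X_power X_pderiv2_power X_pderiv_power D_def N_def of_nat_Suc
  by (rule ins_op_monom_ring_identity)

lemma P_Suc: "2 * P (Suc n) = ins_op (2 * n + 1) (P n)"
proof -
  have "2 * P (Suc n) = (\<Sum>\<sigma>\<in>double_perms n. 2 * shuffle_sum 0 \<sigma> [Suc n, Suc n])"
    by (simp add: P_Suc_eq_sum sum_distrib_left)
  also have "\<dots> = (\<Sum>\<sigma>\<in>double_perms n. ins_op (2 * n + 1) (des_monom \<sigma>))"
  proof (rule sum.cong)
    fix \<sigma> assume "\<sigma> \<in> double_perms n"
    note props = double_perms_props[OF this]
    have "\<forall>y\<in>set \<sigma>. y < Suc n" using props(2) by auto
    from shuffle_sum_max_max[OF _ this, of 0] props(1)
    show "2 * shuffle_sum 0 \<sigma> [Suc n, Suc n] = ins_op (2 * n + 1) (des_monom \<sigma>)"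
      using ins_op_monom[of "2 * n" "des \<sigma>"] by simp
  qed simp
  finally show ?thesis
    by (simp only: P_def ins_op_sum)
qed

section \<open>Initial values and constant terms\<close>

lemma P_0: "P 0 = 1"
  by (simp add: P_def double_perms_def)

text \<open>Start of the induction: passing from \<open>P 0\<close> to \<open>P 1\<close> uses
  operator index 1, outside the range \<open>e + 2 * k + 3\<close> treated on the gamma
  basis.\<close>

lemma P_1: "P 1 = 1"
proof -
  have "2 * P 1 = ins_op 1 1"
    using P_Suc[of 0] by (simp add: P_0)
  also have "\<dots> = 2 * 1"
    by (simp add: ins_op_def power2_eq_square numeral_poly one_pCons algebra_simps)
  finally show ?thesis by simp
qed

lemma coeff_ins_op_0: "coeff (ins_op m f) 0 = 2 * coeff f 0"
  by (simp add: ins_op_def coeff_mult_0 power2_eq_square numeral_poly)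

lemma coeff_P_0: "coeff (P n) 0 = 1"
proof (induction n)
  case 0
  then show ?case by (simp add: P_0)
next
  case (Suc n)
  have "coeff (2 * P (Suc n)) 0 = 2"
    unfolding P_Suc coeff_ins_op_0 Suc.IH by simp
  then show ?case by (simp add: coeff_mult_0 numeral_poly)
qed

section \<open>The operator on the gamma basis\<close>

text \<open>The logarithmic derivative \<open>K / X + E / U\<close> of \<open>b\<close>, and its
  second-order analogue, cleared of denominators.\<close>

lemma pderiv_gamma_basis:
  fixes k e :: nat
  defines "b \<equiv> X ^ k * U ^ e" and "K \<equiv> of_nat k" and "E \<equiv> of_nat e"
  shows "X * U * pderiv b = (K * U + E * X) * b"
    and "X\<^sup>2 * U\<^sup>2 * pderiv (pderiv b) =
      (K * (K - 1) * U\<^sup>2 + 2 * K * E * X * U + E * (E - 1) * X\<^sup>2) * b"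
proof -
  have "X * U * pderiv b = U * (X * pderiv (X ^ k)) * U ^ e + X * (U * pderiv (U ^ e)) * X ^ k"
    unfolding b_def pderiv_mult
    by (simp add: algebra_simps del: mult_pCons_left mult_pCons_right)
  then show first: "X * U * pderiv b = (K * U + E * X) * b"
    unfolding X_pderiv_power U_pderiv_power b_def K_def E_def
    by (simp add: algebra_simps del: mult_pCons_left mult_pCons_right)
  have "pderiv (X * U * pderiv b) = pderiv ((K * U + E * X) * b)"
    by (simp only: first)
  moreover have "pderiv X = 1" "pderiv U = 1"
    by (simp_all add: pderiv_pCons)
  ultimately have "X * U * pderiv (pderiv b) =
      (K + E) * b + (K * U + E * X - U - X) * pderiv b"
    by (simp add: pderiv_mult pderiv_add K_def E_def algebra_simps
        del: mult_pCons_left mult_pCons_right)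
  \<comment> \<open>After another multiplication by \<open>x * u\<close>, the unknown
    \<open>b'\<close> occurs only as \<open>x * u * b'\<close>, which the first relation
    eliminates.\<close>
  moreover have "x\<^sup>2 * u\<^sup>2 * b'' =
      (K * (K - 1) * u\<^sup>2 + 2 * K * E * x * u + E * (E - 1) * x\<^sup>2) * b"
    if b': "x * u * b' = (K * u + E * x) * b"
      and b'': "x * u * b'' = (K + E) * b + (K * u + E * x - u - x) * b'" for x u b' b''
  proof -
    have "x\<^sup>2 * u\<^sup>2 * b'' = x * u * (x * u * b'')"
      by (simp add: algebra_simps power2_eq_square)
    also have "\<dots> = x * u * (K + E) * b + (K * u + E * x - u - x) * (x * u * b')"
      unfolding b'' by (simp add: algebra_simps)
    also have "\<dots> = (K * (K - 1) * u\<^sup>2 + 2 * K * E * x * u + E * (E - 1) * x\<^sup>2) * b"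
      unfolding b' by (simp add: algebra_simps power2_eq_square)
    finally show ?thesis .
  qed
  ultimately show "X\<^sup>2 * U\<^sup>2 * pderiv (pderiv b) =
      (K * (K - 1) * U\<^sup>2 + 2 * K * E * X * U + E * (E - 1) * X\<^sup>2) * b"
    using first by blast
qed

text \<open>The factor \<open>u\<^sup>2\<close> makes both derivative relations applicable. The
  value of \<open>m\<close> is \<open>2 n + 1\<close> written for a basis element with
  \<open>e + 2 k = 2 n - 2\<close>.\<close>

lemma gamma_basis_ring_identity:
  fixes x u K E b b' b'' m :: "'a :: comm_ring_1"
  assumes u: "u = 1 + x" and m: "m = E + 2 * K + 3"
    and b': "x * u * b' = (K * u + E * x) * b"
    and b'': "x\<^sup>2 * u\<^sup>2 * b'' = (K * (K - 1) * u\<^sup>2 + 2 * K * E * x * u + E * (E - 1) * x\<^sup>2) * b"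
  shows "u\<^sup>2 * ((1 - x)\<^sup>2 * (x\<^sup>2 * b'')
     + (4 * (1 - x)\<^sup>2 + 2 * m * x * (1 - x)) * (x * b')
     + (2 * (1 - x)\<^sup>2 + 4 * m * x * (1 - x) + m * (m + 1) * x\<^sup>2) * b)
   = (K + 1) * (K + 2) * u\<^sup>2 * u\<^sup>2 * b + 2 * (K + 2) * (2 * E + 1) * x * u\<^sup>2 * b
     + 4 * E * (E - 1) * x\<^sup>2 * b"
proof -
  have "u\<^sup>2 * ((1 - x)\<^sup>2 * (x\<^sup>2 * b'')
     + (4 * (1 - x)\<^sup>2 + 2 * m * x * (1 - x)) * (x * b')
     + (2 * (1 - x)\<^sup>2 + 4 * m * x * (1 - x) + m * (m + 1) * x\<^sup>2) * b)
     = (1 - x)\<^sup>2 * (x\<^sup>2 * u\<^sup>2 * b'')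
     + (4 * (1 - x)\<^sup>2 + 2 * m * x * (1 - x)) * u * (x * u * b')
     + (2 * (1 - x)\<^sup>2 + 4 * m * x * (1 - x) + m * (m + 1) * x\<^sup>2) * u\<^sup>2 * b"
    by (simp add: algebra_simps power2_eq_square)
  then show ?thesis unfolding b' b'' unfolding u m by (simp add: algebra_simps power2_eq_square)
qed

lemma ins_op_gamma_basis:
  "ins_op (e + 2 * k + 3) (X ^ k * U ^ e) =
     of_nat ((k + 1) * (k + 2)) * (X ^ k * U ^ (e + 2))
   + of_nat (2 * (k + 2) * (2 * e + 1)) * (X ^ (k + 1) * U ^ e)
   + of_nat (4 * e * (e - 1)) * (X ^ (k + 2) * U ^ (e - 2))" (is "?l = ?r")
proof -
  define b K E m where "b = X ^ k * U ^ e" and "K = (of_nat k :: real poly)"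
    and "E = (of_nat e :: real poly)" and "m = (of_nat (e + 2 * k + 3) :: real poly)"
  have U: "U = 1 + X" by (simp add: one_pCons)
  have m: "m = E + 2 * K + 3" by (simp add: m_def E_def K_def)
  have b1: "X * U * pderiv b = (K * U + E * X) * b"
    and b2: "X\<^sup>2 * U\<^sup>2 * pderiv (pderiv b) =
      (K * (K - 1) * U\<^sup>2 + 2 * K * E * X * U + E * (E - 1) * X\<^sup>2) * b"
    unfolding b_def K_def E_def by (rule pderiv_gamma_basis)+
  have "U\<^sup>2 * ?l = (K + 1) * (K + 2) * U\<^sup>2 * U\<^sup>2 * b
     + 2 * (K + 2) * (2 * E + 1) * X * U\<^sup>2 * b + 4 * E * (E - 1) * X\<^sup>2 * b"
    unfolding ins_op_def b_def[symmetric] m_def[symmetric]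
    by (rule gamma_basis_ring_identity[OF U m b1 b2])
  \<comment> \<open>For \<open>e\<close> below 2 both sides vanish, so the truncated
    \<open>e - 1\<close> and \<open>e - 2\<close> do no harm.\<close>
  also have "4 * E * (E - 1) * X\<^sup>2 * b =
      U\<^sup>2 * (of_nat (4 * e * (e - 1)) * (X ^ (k + 2) * U ^ (e - 2)))"
  proof -
    consider "e = 0" | "e = 1" | j where "e = j + 2"
      by (metis One_nat_def add_2_eq_Suc' not0_implies_Suc)
    then show ?thesis
    proof cases
      case 3
      then have E: "4 * E * (E - 1) = of_nat (4 * e * (e - 1))"
        by (simp add: E_def algebra_simps)
      have b: "b = X ^ k * (U ^ (e - 2) * U\<^sup>2)"
        unfolding b_def power_add[symmetric] using 3 by simp
      show ?thesis
        unfolding E b power_add by (simp only: mult_ac)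
    qed (simp_all add: E_def)
  qed
  also have "(K + 1) * (K + 2) * U\<^sup>2 * U\<^sup>2 * b =
      U\<^sup>2 * (of_nat ((k + 1) * (k + 2)) * (X ^ k * U ^ (e + 2)))"
    unfolding K_def b_def power_add of_nat_mult of_nat_add of_nat_1 of_nat_numeral
    by (simp only: mult_ac)
  also have "2 * (K + 2) * (2 * E + 1) * X * U\<^sup>2 * b =
      U\<^sup>2 * (of_nat (2 * (k + 2) * (2 * e + 1)) * (X ^ (k + 1) * U ^ e))"
    unfolding K_def E_def b_def power_add power_one_right of_nat_mult of_nat_add of_nat_1
      of_nat_numeral
    by (simp only: mult_ac)
  finally have "U\<^sup>2 * ?l = U\<^sup>2 * ?r"
    by (simp only: distrib_left)
  moreover have "U\<^sup>2 \<noteq> 0" by simp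
  ultimately show ?thesis by (simp only: mult_cancel_left) blast
qed

section \<open>The cone of nonnegative gamma expansions\<close>

text \<open>The nominal degree \<open>2 * m\<close> replaces \<open>degree f\<close>, so that the
  set is a convex cone containing 0 and the true degree can be settled afterwards.\<close>

definition gamma_cone :: "nat \<Rightarrow> real poly set" where
  "gamma_cone m = {f. \<exists>\<gamma>. (\<forall>k. \<gamma> k \<ge> 0) \<and>
     f = (\<Sum>k\<le>m. smult (\<gamma> k) (X ^ k * U ^ (2 * m - 2 * k)))}"

lemma gamma_cone_0: "0 \<in> gamma_cone m"
  unfolding gamma_cone_def by (auto intro!: exI[of _ "\<lambda>_. 0"])

lemma gamma_cone_add:
  assumes "f \<in> gamma_cone m" "g \<in> gamma_cone m"
  shows "f + g \<in> gamma_cone m"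
proof -
  obtain \<gamma> \<delta> where "\<forall>k. \<gamma> k \<ge> 0" "\<forall>k. \<delta> k \<ge> 0"
    "f = (\<Sum>k\<le>m. smult (\<gamma> k) (X ^ k * U ^ (2 * m - 2 * k)))"
    "g = (\<Sum>k\<le>m. smult (\<delta> k) (X ^ k * U ^ (2 * m - 2 * k)))"
    using assms by (auto simp: gamma_cone_def)
  then show ?thesis unfolding gamma_cone_def
    by (auto intro!: exI[of _ "\<lambda>k. \<gamma> k + \<delta> k"] simp: sum.distrib smult_add_left)
qed

lemma gamma_cone_smult:
  assumes "f \<in> gamma_cone m" "c \<ge> 0"
  shows "smult c f \<in> gamma_cone m"
proof -
  obtain \<gamma> where "\<forall>k. \<gamma> k \<ge> 0"
    "f = (\<Sum>k\<le>m. smult (\<gamma> k) (X ^ k * U ^ (2 * m - 2 * k)))"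
    using assms by (auto simp: gamma_cone_def)
  moreover have "smult c (sum g A) = (\<Sum>k\<in>A. smult c (g k))" for g :: "nat \<Rightarrow> real poly" and A
    by (induction A rule: infinite_finite_induct) (simp_all add: smult_add_right)
  ultimately show ?thesis unfolding gamma_cone_def using assms(2)
    by (auto intro!: exI[of _ "\<lambda>k. c * \<gamma> k"])
qed

lemma gamma_cone_of_nat_mult:
  assumes "f \<in> gamma_cone m"
  shows "of_nat c * f \<in> gamma_cone m"
  using gamma_cone_smult[OF assms, of "of_nat c"] by (simp add: of_nat_poly)

lemma gamma_cone_sum:
  assumes "\<And>a. a \<in> A \<Longrightarrow> f a \<in> gamma_cone m"
  shows "sum f A \<in> gamma_cone m"
  using assms
  by (induction A rule: infinite_finite_induct) (simp_all add: gamma_cone_0 gamma_cone_add)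

lemma gamma_cone_basis:
  assumes "k \<le> m" "e = 2 * m - 2 * k"
  shows "X ^ k * U ^ e \<in> gamma_cone m"
proof -
  have "(\<Sum>j\<le>m. smult (of_bool (j = k)) (X ^ j * U ^ (2 * m - 2 * j))) =
      (\<Sum>j\<in>{k}. smult (of_bool (j = k)) (X ^ j * U ^ (2 * m - 2 * j)))"
    using assms(1) by (intro sum.mono_neutral_right) auto
  then show ?thesis unfolding gamma_cone_def assms(2)
    by (auto intro!: exI[of _ "\<lambda>j. of_bool (j = k)"])
qed

lemma ins_op_gamma_cone:
  assumes "f \<in> gamma_cone m"
  shows "ins_op (2 * m + 3) f \<in> gamma_cone (Suc m)"
proof -
  obtain \<gamma> where \<gamma>: "\<forall>k. \<gamma> k \<ge> 0"
    and f: "f = (\<Sum>k\<le>m. smult (\<gamma> k) (X ^ k * U ^ (2 * m - 2 * k)))"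
    using assms by (auto simp: gamma_cone_def)
  have "ins_op (2 * m + 3) (X ^ k * U ^ (2 * m - 2 * k)) \<in> gamma_cone (Suc m)"
    if "k \<le> m" for k
  proof -
    define e where "e = 2 * m - 2 * k"
    have m: "2 * m + 3 = e + 2 * k + 3" using that by (simp add: e_def)
    have 1: "of_nat ((k + 1) * (k + 2)) * (X ^ k * U ^ (e + 2)) \<in> gamma_cone (Suc m)"
      using that by (intro gamma_cone_of_nat_mult gamma_cone_basis) (auto simp: e_def)
    have 2: "of_nat (2 * (k + 2) * (2 * e + 1)) * (X ^ (k + 1) * U ^ e) \<in> gamma_cone (Suc m)"
      using that by (intro gamma_cone_of_nat_mult gamma_cone_basis) (auto simp: e_def)
    \<comment> \<open>For \<open>k = m\<close> the index \<open>k + 2\<close> would exceed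
      \<open>Suc m\<close>, but then \<open>e = 0\<close> and the coefficient vanishes. Otherwise
      \<open>e\<close>, being even, is at least 2.\<close>
    have 3: "of_nat (4 * e * (e - 1)) * (X ^ (k + 2) * U ^ (e - 2)) \<in> gamma_cone (Suc m)"
    proof (cases "e = 0")
      case True
      then show ?thesis by (simp add: gamma_cone_0)
    next
      case False
      then show ?thesis
        by (intro gamma_cone_of_nat_mult gamma_cone_basis) (auto simp: e_def)
    qed
    show ?thesis
      unfolding e_def[symmetric] m ins_op_gamma_basis by (intro gamma_cone_add 1 2 3)
  qed
  then show ?thesis
    unfolding f ins_op_sum ins_op_smult using \<gamma>
    by (intro gamma_cone_sum gamma_cone_smult) auto
qed

lemma P_in_gamma_cone: "P (Suc m) \<in> gamma_cone m"
proof (induction m)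
  case 0
  then show ?case using gamma_cone_basis[of 0 0 0] P_1 by simp
next
  case (Suc m)
  \<comment> \<open>The factor \<open>1 / 2\<close> undoes the doubling in \<open>P_Suc\<close>,
    whose index is \<open>2 * Suc m + 1 = 2 * m + 3\<close>.\<close>
  have "smult (1 / 2) (2 * P (Suc (Suc m))) \<in> gamma_cone (Suc m)"
    using ins_op_gamma_cone[OF Suc.IH] unfolding P_Suc
    by (intro gamma_cone_smult) (simp_all add: numeral_3_eq_3)
  then show ?case by (simp add: numeral_poly)
qed

section \<open>Consequences of a nonnegative gamma expansion\<close>

lemma coeff_gamma_basis:
  "coeff (X ^ k * U ^ e) i = (if i < k then 0 else real (e choose (i - k)))"
proof -
  have "coeff (U ^ e) j = real (e choose j)" for j
    by (cases "j \<le> e")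
      (simp_all add: coeff_linear_poly_power coeff_eq_0 degree_linear_power binomial_eq_0)
  then show ?thesis by (simp add: coeff_monom_mult flip: monom_eq_X_power)
qed

lemma coeff_gamma_basis_symmetric:
  assumes "k \<le> m" "i \<le> 2 * m"
  shows "coeff (X ^ k * U ^ (2 * m - 2 * k)) (2 * m - i) = coeff (X ^ k * U ^ (2 * m - 2 * k)) i"
proof -
  \<comment> \<open>The coefficients are supported on the indices from \<open>k\<close> to
    \<open>2 * m - k\<close>; reflection swaps the two outer ranges, and inside it is binomial
    symmetry.\<close>
  consider "i < k" | "k \<le> i" "i \<le> 2 * m - k" | "2 * m - k < i" by linarith
  then show ?thesis
  proof cases
    case 2
    then have "2 * m - i - k = 2 * m - 2 * k - (i - k)" "i - k \<le> 2 * m - 2 * k"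
      using assms by auto
    then show ?thesis using 2 assms binomial_symmetric[of "i - k" "2 * m - 2 * k"]
      by (auto simp: coeff_gamma_basis)
  qed (use assms in \<open>auto simp: coeff_gamma_basis intro!: binomial_eq_0\<close>)
qed

text \<open>Row \<open>2 * m - 2 * k\<close> of Pascal's triangle increases up to its middle
  \<open>m - k\<close>, which the shift by \<open>k\<close> moves to \<open>m\<close>.\<close>

lemma coeff_gamma_basis_mono:
  assumes "k \<le> m" "i < m"
  shows "coeff (X ^ k * U ^ (2 * m - 2 * k)) i \<le> coeff (X ^ k * U ^ (2 * m - 2 * k)) (Suc i)"
  using assms by (auto simp: coeff_gamma_basis intro!: binomial_mono)

lemma gamma_cone_coeff_symmetric:
  assumes "f \<in> gamma_cone m" "i \<le> 2 * m"
  shows "coeff f (2 * m - i) = coeff f i"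
  using assms
  by (auto simp: gamma_cone_def coeff_sum coeff_gamma_basis_symmetric intro!: sum.cong)

lemma gamma_cone_coeff_mono:
  assumes "f \<in> gamma_cone m" "i < m"
  shows "coeff f i \<le> coeff f (Suc i)"
  using assms
  by (auto simp: gamma_cone_def coeff_sum intro!: sum_mono mult_left_mono coeff_gamma_basis_mono)

text \<open>Symmetry carries the nonzero constant term to index \<open>2 * m\<close>.\<close>

lemma gamma_cone_degree:
  assumes "f \<in> gamma_cone m" "coeff f 0 \<noteq> 0"
  shows "degree f = 2 * m"
proof (rule antisym)
  show "degree f \<le> 2 * m"
  proof (rule degree_le, intro allI impI)
    fix i assume "2 * m < i"
    then show "coeff f i = 0"
      using assms(1) by (auto simp: gamma_cone_def coeff_sum coeff_gamma_basis intro!: sum.neutral)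
  qed
  show "2 * m \<le> degree f"
    using gamma_cone_coeff_symmetric[OF assms(1), of 0] assms(2) by (intro le_degree) simp
qed

theorem proposition2:
  fixes n :: nat
  assumes "n \<ge> 1"
  shows "degree (P n) = 2 * n - 2 \<and> symmetric_poly (P n) \<and>
         gamma_positive (P n) \<and> unimodal_with_mode (P n) (n - 1)"
proof -
  obtain m where n: "n = Suc m" using assms by (cases n) auto
  have cone: "P n \<in> gamma_cone m" unfolding n by (rule P_in_gamma_cone)
  have deg: "degree (P n) = 2 * m"
    using gamma_cone_degree[OF cone] by (simp add: coeff_P_0)
  have sym: "symmetric_poly (P n)"
    unfolding symmetric_poly_def deg using gamma_cone_coeff_symmetric[OF cone] by simp
  \<comment> \<open>With the degree known to be \<open>2 * m\<close>, the expansion given by the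
    cone is literally the gamma expansion.\<close>
  moreover have "gamma_positive (P n)"
    using cone sym unfolding gamma_positive_def gamma_expansion_def deg
    by (auto simp: gamma_cone_def)
  moreover have "unimodal_with_mode (P n) m"
    unfolding unimodal_with_mode_def deg
  proof (intro conjI allI ballI impI)
    fix i assume "i \<in> {m..<2 * m}"
    \<comment> \<open>Reflection sends the pair \<open>i\<close>, \<open>Suc i\<close> to
      \<open>2 * m - i\<close>, \<open>2 * m - Suc i\<close> in the increasing half.\<close>
    then have i: "2 * m - Suc i < m" "Suc (2 * m - Suc i) = 2 * m - i" "Suc i \<le> 2 * m" by auto
    then show "coeff (P n) i \<ge> coeff (P n) (Suc i)"
      using gamma_cone_coeff_mono[OF cone i(1)] gamma_cone_coeff_symmetric[OF cone, of i]
        gamma_cone_coeff_symmetric[OF cone, of "Suc i"] by simp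
  qed (use gamma_cone_coeff_mono[OF cone] in auto)
  ultimately show ?thesis using deg by (simp add: n)
qed

end
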